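(* For integers $n\geq 0$ let $P_n(x)=2^{-2n}\sum_{j=0}^{n} 2^j\binom{2n-2j}{n-j}\binom{n+j}{j}(x+1)^j$ and write $P_n(x)=\sum_{i=0}^n d_i(n)x^i$. Define $R_n(x)=\sum_{i=0}^n \frac{d_i(n)}{(i+2)!}x^i$. Then for every $n\geq 1$, $$R_{n+1}(x)=\left(\frac{(2n+1)x}{(n+1)(n+3)}+\frac{8n^2+8n+7}{2(n+1)(n+3)}\right)R_n(x)-\frac{(4n-1)(4n+1)(n-2)}{4n(n+1)(n+3)}R_{n-1}(x)+\frac{5x}{(n+1)(n+3)}R_n'(x).$$
   Context: $P_n(x)$ are the Boros–Moll polynomials and $d_i(n)$ their coefficients; $R_n'$ denotes the derivative of $R_n$ with respect to $x$. *)

theory Defs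
  imports Complex_Main "HOL-Computational_Algebra.Polynomial"
begin

definition boros_moll :: "nat \<Rightarrow> real poly" where
  "boros_moll n = smult (1 / 2 ^ (2 * n))
     (\<Sum>j = 0..n. smult (2 ^ j * real ((2 * n - 2 * j) choose (n - j)) * real ((n + j) choose j))
        ([:1, 1:] ^ j))"

definition boros_moll_coeff :: "nat \<Rightarrow> nat \<Rightarrow> real" where
  "boros_moll_coeff i n = coeff (boros_moll n) i"

definition R_poly :: "nat \<Rightarrow> real poly" where
  "R_poly n = (\<Sum>i = 0..n. monom (boros_moll_coeff i n / fact (i + 2)) i)"

end

theory Submission
  imports Defs
begin

text \<open>
  In the basis of powers of \<open>y = x + 1\<close> the Boros--Moll polynomial has hypergeometric
  coefficients, and multiplying the \<open>i\<close>-th coefficient of \<open>R n\<close> by \<open>(i + 2)!\<close> turns the claim into a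
  relation between \<open>P (n + 1)\<close>, \<open>P n\<close>, \<open>P' n\<close> and \<open>P (n - 1)\<close> in which the derivative occurs
  only to first order. Comparing coefficients of powers of \<open>y\<close>, all terms are rational multiples
  of a single hypergeometric term, so the relation reduces to a rational function identity.
\<close>

section \<open>Coefficients in powers of y = x + 1 and their ratios\<close>

definition shifted_coeff :: "nat \<Rightarrow> nat \<Rightarrow> real" where
  "shifted_coeff n j = (if j \<le> n then 2 ^ j * real ((2 * n - 2 * j) choose (n - j))
     * real ((n + j) choose j) / 2 ^ (2 * n) else 0)"

text \<open>Writing \<open>n\<close> as \<open>j + m\<close> avoids truncated subtraction; in
  factorial form the ratios of neighbouring terms can be read off as rational functions.\<close>

lemma shifted_coeff_fact:
  "shifted_coeff (j + m) j
     = fact (2 * m) * fact (2 * j + m) / (2 ^ (j + 2 * m) * fact m ^ 2 * fact j * fact (j + m))"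
proof -
  have "real ((2 * m) choose m) = fact (2 * m) / (fact m * fact m)"
    using binomial_fact[of m "2 * m", where ?'a = real] by simp
  moreover have "real ((j + m + j) choose j) = fact (2 * j + m) / (fact j * fact (j + m))"
    using binomial_fact[of j "j + m + j", where ?'a = real] by (simp add: mult_2 add_ac)
  moreover have "(2::real) ^ (2 * (j + m)) = 2 ^ j * 2 ^ (j + 2 * m)"
    by (simp flip: power_add)
  moreover have "2 * (j + m) - 2 * j = 2 * m"
    by simp
  ultimately show ?thesis
    unfolding shifted_coeff_def by (simp add: power2_eq_square)
qed

text \<open>A term ratio cleared of denominators, so that it holds for every \<open>j\<close>. At
  \<open>j = n + 1\<close> the left side vanishes through the factor \<open>n - j + 1\<close>, the
  right side through the cut-off in \<open>shifted_coeff\<close>; without the cut-off, truncated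
  subtraction would make the first binomial 1 there.\<close>

lemma shifted_coeff_Suc_degree:
  "2 * (real n - real j + 1) * (real n + 1) * shifted_coeff (Suc n) j
     = (2 * real n - 2 * real j + 1) * (real n + real j + 1) * shifted_coeff n j"
proof (cases "j \<le> n")
  case True
  then obtain m where n: "n = j + m"
    using le_Suc_ex by blast
  have f: "fact (2 * Suc m) = (2 * real m + 2) * (2 * real m + 1) * fact (2 * m)"
    by (simp add: algebra_simps)
  have g: "fact (2 * j + Suc m) = (2 * real j + real m + 1) * fact (2 * j + m)"
    by simp
  have h: "fact (j + Suc m) = (real j + real m + 1) * fact (j + m)"
      "fact (Suc m) = (real m + 1) * fact m"
    by simp_all
  have p: "(2::real) ^ (j + 2 * Suc m) = 4 * 2 ^ (j + 2 * m)"
    by simp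
  have nz: "real m + 1 \<noteq> 0" "real j + real m + 1 \<noteq> 0"
    by linarith+
  have "shifted_coeff (Suc n) j
     = fact (2 * Suc m) * fact (2 * j + Suc m)
       / (2 ^ (j + 2 * Suc m) * fact (Suc m) ^ 2 * fact j * fact (j + Suc m))"
    using shifted_coeff_fact[of j "Suc m"] n by simp
  also have "\<dots> = (2 * real m + 1) * (2 * real j + real m + 1)
       / (2 * (real m + 1) * (real j + real m + 1)) * shifted_coeff (j + m) j"
    unfolding f g h p shifted_coeff_fact using nz
    by (simp add: divide_simps power2_eq_square) algebra
  finally show ?thesis
    using nz by (simp add: n divide_simps) algebra
qed (auto simp: shifted_coeff_def not_le le_Suc_eq)

text \<open>The diagonal step keeps \<open>m = n - j\<close> fixed, so the central binomial
  coefficient cancels and only the other binomial and the powers of 2 contribute.\<close>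

lemma shifted_coeff_Suc_Suc:
  "2 * (real n + 1) * (real j + 1) * shifted_coeff (Suc n) (Suc j)
     = (real n + real j + 1) * (real n + real j + 2) * shifted_coeff n j"
proof (cases "j \<le> n")
  case True
  then obtain m where n: "n = j + m"
    using le_Suc_ex by blast
  have g: "fact (2 * Suc j + m)
      = (2 * real j + real m + 2) * (2 * real j + real m + 1) * fact (2 * j + m)"
    by (simp add: algebra_simps)
  have h: "fact (Suc j + m) = (real j + real m + 1) * fact (j + m)"
      "fact (Suc j) = (real j + 1) * fact j"
    by simp_all
  have p: "(2::real) ^ (Suc j + 2 * m) = 2 * 2 ^ (j + 2 * m)"
    by simp
  have nz: "real j + 1 \<noteq> 0" "real j + real m + 1 \<noteq> 0"
    by linarith+
  have "shifted_coeff (Suc n) (Suc j) = shifted_coeff (Suc j + m) (Suc j)"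
    using n by simp
  also have "\<dots> = (2 * real j + real m + 2) * (2 * real j + real m + 1)
       / (2 * (real j + 1) * (real j + real m + 1)) * shifted_coeff (j + m) j"
    unfolding g h p shifted_coeff_fact using nz
    by (simp add: divide_simps)
  finally show ?thesis
    using nz by (simp add: n divide_simps) algebra
qed (simp add: shifted_coeff_def)

section \<open>Recurrence for the Boros-Moll polynomials, first in y, then in x = y - 1\<close>

definition shifted_boros_moll :: "nat \<Rightarrow> real poly" where
  "shifted_boros_moll n = (\<Sum>j = 0..n. monom (shifted_coeff n j) j)"

lemma coeff_shifted_boros_moll: "coeff (shifted_boros_moll n) j = shifted_coeff n j"
  by (auto simp: shifted_boros_moll_def coeff_sum shifted_coeff_def)

lemma pcompose_monom: "pcompose (monom a n) p = smult a (p ^ n)"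
  by (induction n) (simp_all add: monom_0 monom_Suc pcompose_pCons)

lemma boros_moll_eq_pcompose: "boros_moll n = pcompose (shifted_boros_moll n) [:1, 1:]"
proof -
  have "boros_moll n = (\<Sum>j = 0..n. smult (shifted_coeff n j) ([:1, 1:] ^ j))"
    by (rule poly_eqI) (simp add: boros_moll_def coeff_sum sum_distrib_left shifted_coeff_def)
  then show ?thesis
    by (simp add: shifted_boros_moll_def pcompose_sum pcompose_monom)
qed

text \<open>Here \<open>y\<close> is the index \<open>j\<close> as a real number. The bracket after
  \<open>2 * n + 1\<close> is the \<open>j\<close>-th coefficient of 3(t - 1)Q + (t - 1)^2 Q', and
  the bracket after 5 that of (t - 1)Q', where Q has coefficients \<open>c\<close>.\<close>

lemma shifted_coeff_recurrence:
  fixes m j :: nat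
  defines "n \<equiv> real m + 1" and "y \<equiv> real j"
  defines "c \<equiv> shifted_coeff (m + 1)"
  shows "(n + 1) * (n + 3) * shifted_coeff (m + 2) j
    = (2 * n + 1) * ((y + 2) * (if j = 0 then 0 else c (j - 1))
                      - (2 * y + 3) * c j + (y + 1) * c (j + 1))
      + (8 * n ^ 2 + 8 * n + 7) / 2 * c j + 5 * (y * c j - (y + 1) * c (j + 1))
      - (4 * n - 1) * (4 * n + 1) * (n - 2) / (4 * n) * shifted_coeff m j"
proof -
  define a c0 c1 s e where "a = shifted_coeff m j" and "c0 = c j" and "c1 = c (j + 1)"
    and "s = shifted_coeff (m + 2) j" and "e = (if j = 0 then 0 else c (j - 1))"
  note defs = a_def c0_def c1_def s_def e_def c_def
  have pos: "n > 0" "y \<ge> 0" "n + y > 0"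
    by (simp_all add: n_def y_def)
  \<comment> \<open>At \<open>j = 0\<close> both sides are zero, by \<open>y = 0\<close> and by the
    default value of \<open>e\<close>.\<close>
  have E1: "2 * (n + 1) * y * s = (n + y) * (n + y + 1) * e"
    using shifted_coeff_Suc_Suc[of "m + 1" "j - 1"]
    by (cases j) (simp_all add: defs n_def y_def algebra_simps)
  have E2: "2 * n * (y + 1) * c1 = (n + y) * (n + y + 1) * a"
    using shifted_coeff_Suc_Suc[of m j] by (simp add: defs n_def y_def algebra_simps)
  have E3: "2 * (n - y + 1) * (n + 1) * s = (2 * n - 2 * y + 1) * (n + y + 1) * c0"
    using shifted_coeff_Suc_degree[of "m + 1" j] by (simp add: defs n_def y_def algebra_simps)
  have E4: "2 * (n - y) * n * c0 = (2 * n - 2 * y - 1) * (n + y) * a"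
    using shifted_coeff_Suc_degree[of m j] by (simp add: defs n_def y_def algebra_simps)
  have e: "e = 2 * (n + 1) * y * s / ((n + y) * (n + y + 1))"
    using E1 pos by (simp add: divide_simps)
  have c1: "c1 = (n + y) * (n + y + 1) * a / (2 * n * (y + 1))"
    using E2 pos by (simp add: divide_simps) algebra
  have "(n + 1) * (n + 3) * s
    = (2 * n + 1) * ((y + 2) * e - (2 * y + 3) * c0 + (y + 1) * c1)
      + (8 * n ^ 2 + 8 * n + 7) / 2 * c0 + 5 * (y * c0 - (y + 1) * c1)
      - (4 * n - 1) * (4 * n + 1) * (n - 2) / (4 * n) * a"
  proof -
    \<comment> \<open>\<open>e\<close> and \<open>c1\<close> can be solved for at every
      \<open>j\<close>, but E4 degenerates at \<open>y = n\<close> and E3 at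
      \<open>y = n + 1\<close>. The term on which all others depend is therefore \<open>a\<close>,
      then \<open>c0\<close>, then \<open>s\<close>; beyond that all terms vanish.\<close>
    consider "j \<le> m" | "j = m + 1" | "j = m + 2" | "j > m + 2"
      by linarith
    then show ?thesis
    proof cases
      case 1
      then have ny: "n - y > 0"
        by (simp add: n_def y_def)
      have c0: "c0 = (2 * n - 2 * y - 1) * (n + y) * a / (2 * (n - y) * n)"
        using E4 pos ny by (simp add: divide_simps) algebra
      have s: "s = (2 * n - 2 * y + 1) * (n + y + 1) * c0 / (2 * (n - y + 1) * (n + 1))"
        using E3 pos ny by (simp add: divide_simps) algebra
      have nz: "n \<noteq> 0" "n + 1 \<noteq> 0" "y + 1 \<noteq> 0" "n + y \<noteq> 0" "n + y + 1 \<noteq> 0" "n - y \<noteq> 0"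
          "n - y + 1 \<noteq> 0"
        using pos ny by linarith+
      show ?thesis
        unfolding e c1 s c0 using nz by (simp add: divide_simps) algebra
    next
      case 2
      then have y: "y = n" and a: "a = 0"
        by (simp_all add: y_def n_def a_def shifted_coeff_def)
      have s: "s = (2 * n + 1) * c0 / (2 * (n + 1))"
        using E3 pos by (simp add: y divide_simps mult.commute)
      show ?thesis
        unfolding e c1 s a y using pos by (simp add: divide_simps) algebra
    next
      case 3
      then have y: "y = n + 1" and z: "a = 0" "c0 = 0"
        by (simp_all add: y_def n_def defs shifted_coeff_def)
      show ?thesis
        unfolding e c1 z y using pos by (simp add: divide_simps) algebra
    next
      case 4
      then show ?thesis
        by (simp add: defs shifted_coeff_def)
    qed
  qed
  then show ?thesis
    by (simp only: a_def c0_def c1_def s_def e_def)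
qed

text \<open>\<open>[:-1, 1:]\<close> is x written in the variable y. The combination 3xP + x^2 P' is
  chosen because its \<open>i\<close>-th coefficient in x is (3 + (i - 1)) d_{i-1} = (i + 2)
  d_{i-1}, which is what x R_n contributes after multiplication by (i + 2)!.\<close>

lemma shifted_boros_moll_recurrence:
  fixes m :: nat
  defines "n \<equiv> real m + 1"
  shows "smult ((n + 1) * (n + 3)) (shifted_boros_moll (m + 2))
    = smult (2 * n + 1) (smult 3 ([:-1, 1:] * shifted_boros_moll (m + 1))
        + [:-1, 1:] * ([:-1, 1:] * pderiv (shifted_boros_moll (m + 1))))
      + smult ((8 * n ^ 2 + 8 * n + 7) / 2) (shifted_boros_moll (m + 1))
      + smult 5 ([:-1, 1:] * pderiv (shifted_boros_moll (m + 1)))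
      - smult ((4 * n - 1) * (4 * n + 1) * (n - 2) / (4 * n)) (shifted_boros_moll m)"
proof (rule poly_eqI, goal_cases)
  case (1 j)
  \<comment> \<open>Two factors \<open>[:-1, 1:]\<close> shift indices by up to two, so the two
    lowest coefficients are treated separately.\<close>
  consider "j = 0" | "j = 1" | i where "j = Suc (Suc i)"
    by (metis One_nat_def not0_implies_Suc)
  then show ?case
    using shifted_coeff_recurrence[of m j]
    by cases (simp_all add: n_def coeff_pCons coeff_pderiv coeff_shifted_boros_moll
      ring_distribs algebra_simps)
qed

text \<open>Substituting y = x + 1 turns \<open>[:-1, 1:]\<close> into \<open>[:0, 1:]\<close> and
  commutes with \<open>pderiv\<close>, because the inner polynomial has derivative 1.\<close>

lemma boros_moll_recurrence:
  fixes m :: nat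
  defines "n \<equiv> real m + 1"
  shows "smult ((n + 1) * (n + 3)) (boros_moll (m + 2))
    = smult (2 * n + 1) (smult 3 ([:0, 1:] * boros_moll (m + 1))
        + [:0, 1:] * ([:0, 1:] * pderiv (boros_moll (m + 1))))
      + smult ((8 * n ^ 2 + 8 * n + 7) / 2) (boros_moll (m + 1))
      + smult 5 ([:0, 1:] * pderiv (boros_moll (m + 1)))
      - smult ((4 * n - 1) * (4 * n + 1) * (n - 2) / (4 * n)) (boros_moll m)"
proof -
  have x: "pcompose [:-1, 1:] [:1, 1:] = ([:0, 1:] :: real poly)"
    by (simp add: pcompose_pCons)
  have d: "pderiv (boros_moll k) = pcompose (pderiv (shifted_boros_moll k)) [:1, 1:]" for k
    by (simp add: boros_moll_eq_pcompose pderiv_pcompose pderiv_pCons)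
  show ?thesis
    using arg_cong[OF shifted_boros_moll_recurrence[of m], of "\<lambda>p. pcompose p [:1, 1:]"]
    unfolding d unfolding boros_moll_eq_pcompose n_def
    by (simp only: pcompose_add pcompose_diff pcompose_smult pcompose_mult x)
qed

lemma boros_moll_coeff_recurrence:
  fixes m i :: nat
  defines "n \<equiv> real m + 1"
  shows "(n + 1) * (n + 3) * boros_moll_coeff i (m + 2)
    = (2 * n + 1) * (real i + 2) * (if i = 0 then 0 else boros_moll_coeff (i - 1) (m + 1))
      + ((8 * n ^ 2 + 8 * n + 7) / 2 + 5 * real i) * boros_moll_coeff i (m + 1)
      - (4 * n - 1) * (4 * n + 1) * (n - 2) / (4 * n) * boros_moll_coeff i m"
proof -
  consider "i = 0" | "i = 1" | k where "i = Suc (Suc k)"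
    by (metis One_nat_def not0_implies_Suc)
  then show ?thesis
    using arg_cong[OF boros_moll_recurrence[of m], of "\<lambda>p. coeff p i"]
    by cases (simp_all add: n_def boros_moll_coeff_def coeff_pCons coeff_pderiv
      ring_distribs algebra_simps)
qed

section \<open>Passage to \<open>R_poly\<close>\<close>

lemma coeff_R_poly: "coeff (R_poly n) i = boros_moll_coeff i n / fact (i + 2)"
proof (cases "i \<le> n")
  case False
  \<comment> \<open>Composition with a linear polynomial preserves the degree bound, so the
    coefficient formula extends past \<open>n\<close> and the final comparison needs no range
    condition on \<open>i\<close>.\<close>
  have "degree (boros_moll n) \<le> n"
    unfolding boros_moll_eq_pcompose degree_pcompose
    by (auto intro!: degree_le simp: coeff_shifted_boros_moll shifted_coeff_def)
  with False have "boros_moll_coeff i n = 0"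
    by (simp add: boros_moll_coeff_def coeff_eq_0)
  with False show ?thesis
    by (simp add: R_poly_def coeff_sum)
qed (simp add: R_poly_def coeff_sum)

theorem theorem2p4:
  fixes n :: nat
  assumes "n \<ge> 1"
  shows "R_poly (n + 1) =
      [: (8 * real n ^ 2 + 8 * real n + 7) / (2 * (real n + 1) * (real n + 3)),
         (2 * real n + 1) / ((real n + 1) * (real n + 3)) :] * R_poly n
    - smult ((4 * real n - 1) * (4 * real n + 1) * (real n - 2)
             / (4 * real n * (real n + 1) * (real n + 3))) (R_poly (n - 1))
    + [: 0, 5 / ((real n + 1) * (real n + 3)) :] * pderiv (R_poly n)"
proof (rule poly_eqI, goal_cases)
  case (1 i)
  define N where "N = real n"
  define f :: real where "f = fact (i + 2)"
  define D where "D = (N + 1) * (N + 3)"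
  define d0 d1 d2 e where "d0 = boros_moll_coeff i (n - 1)" and "d1 = boros_moll_coeff i n"
    and "d2 = boros_moll_coeff i (n + 1)"
    and "e = (if i = 0 then 0 else boros_moll_coeff (i - 1) n)"
  have nz: "N \<noteq> 0" "D \<noteq> 0" "f \<noteq> 0"
    using assms by (auto simp: N_def D_def f_def)
  have rec: "D * d2 = (2 * N + 1) * (real i + 2) * e
      + ((8 * N ^ 2 + 8 * N + 7) / 2 + 5 * real i) * d1
      - (4 * N - 1) * (4 * N + 1) * (N - 2) / (4 * N) * d0"
    using boros_moll_coeff_recurrence[of "n - 1" i] assms
    by (simp add: N_def D_def d0_def d1_def d2_def e_def of_nat_diff)
  \<comment> \<open>The shifted coefficient carries (i + 1)! in its denominator; rewriting it over
    \<open>f\<close> produces the factor i + 2 that occurs in \<open>rec\<close>.\<close>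
  have prev: "(if i = 0 then 0 else coeff (R_poly n) (i - 1)) = (real i + 2) * e / f"
    by (cases i) (simp_all add: coeff_R_poly e_def f_def divide_simps)
  have "coeff ([: (8 * N ^ 2 + 8 * N + 7) / (2 * D), (2 * N + 1) / D :] * R_poly n
      - smult ((4 * N - 1) * (4 * N + 1) * (N - 2) / (4 * N * D)) (R_poly (n - 1))
      + [: 0, 5 / D :] * pderiv (R_poly n)) i
    = (8 * N ^ 2 + 8 * N + 7) / (2 * D) * coeff (R_poly n) i
      + (2 * N + 1) / D * (if i = 0 then 0 else coeff (R_poly n) (i - 1))
      - (4 * N - 1) * (4 * N + 1) * (N - 2) / (4 * N * D) * coeff (R_poly (n - 1)) i
      + 5 / D * real i * coeff (R_poly n) i"
    by (cases i) (simp_all add: coeff_pCons coeff_pderiv)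
  also have "\<dots> = D * d2 / (D * f)"
    unfolding prev rec unfolding coeff_R_poly d0_def[symmetric] d1_def[symmetric] f_def[symmetric]
    using nz by (simp add: divide_simps) algebra
  also have "\<dots> = coeff (R_poly (n + 1)) i"
    using nz by (simp add: coeff_R_poly d2_def f_def)
  finally show ?case
    by (simp only: N_def D_def mult.assoc)
qed

end
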